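(* Let $g\ge2$, $A_{01},A_{12}\in M_g(\mathbb C)$, $F\in M_g(\mathbb C)$, $D,E\in\mathbb C^g$, $c\ge0$, and suppose the block matrix $$\mathcal G=\begin{pmatrix} A_{01} & F & D \\ {F^\dagger} & A_{12} & E \\ {D^\dagger} & E^\dagger & c \end{pmatrix}$$ is positive semidefinite. Suppose the two $g$-dimensional diagonal blocks are rank-one rays, $$A_{01}=|\psi_{01}\rangle\langle\psi_{01}|,\qquad A_{12}=|\psi_{12}\rangle\langle\psi_{12}|,\qquad \psi_{01},\psi_{12}\in\mathbb C^g\setminus\{0\}.$$ Then there exist $\alpha,\beta,\lambda\in\mathbb C$ such that $$D=\alpha\,\psi_{01},\qquad E=\beta\,\psi_{12},\qquad F=\lambda\,|\psi_{01}\rangle\langle\psi_{12}| .$$ Equivalently, $D\in\operatorname{span}\{\psi_{01}\}$, $E\in\operatorname{span}\{\psi_{12}\}$, $\operatorname{Ran}F\subseteq\operatorname{span}\{\psi_{01}\}$ and $\operatorname{Ran}F^\dagger\subseteq\operatorname{span}\{\psi_{12}\}$.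
   Context: The block matrix $\mathcal G$ is the compatibility Gram block of directional data for three energy eigenspaces of dimensions $(1,g,1)$; only its positive semidefiniteness and the rank-one form of the diagonal blocks are used. $\operatorname{Ran}$ denotes the range (column space). *)

theory Defs
  imports Complex_Main "Jordan_Normal_Form.Schur_Decomposition" "Jordan_Normal_Form.VS_Connect"
begin

definition ketbra :: "complex vec \<Rightarrow> complex vec \<Rightarrow> complex mat" where
  "ketbra u v = mat (dim_vec u) (dim_vec v) (\<lambda>(i, j). u $ i * cnj (v $ j))"

(* The order on complex numbers used here is that of HOL-Library.Complex_Order:
   0 \<le> z means that z is real and nonnegative. *)
definition positive_semidefinite :: "complex mat \<Rightarrow> bool" where
  "positive_semidefinite M \<longleftrightarrow>
     square_mat M \<and> mat_adjoint M = M \<and>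
     (\<forall>x \<in> carrier_vec (dim_row M). 0 \<le> (M *\<^sub>v x) \<bullet>c x)"

(* The block matrix with block rows [A01, F, D], [adj F, A12, E], [adj D, adj E, c].
   D and E are stacked into one column, whose adjoint is the block row [adj D, adj E]. *)
definition block_gram ::
  "complex mat \<Rightarrow> complex mat \<Rightarrow> complex mat \<Rightarrow> complex vec \<Rightarrow> complex vec \<Rightarrow> real \<Rightarrow> complex mat" where
  "block_gram A01 A12 F D E c =
     (let DE = mat_of_cols (dim_vec D + dim_vec E) [D @\<^sub>v E]
      in four_block_mat
           (four_block_mat A01 F (mat_adjoint F) A12) DE
           (mat_adjoint DE) (mat 1 1 (\<lambda>_. complex_of_real c)))"

abbreviation vec_span :: "nat \<Rightarrow> complex vec set \<Rightarrow> complex vec set" where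
  "vec_span n S \<equiv> LinearCombinations.module.span class_ring (module_vec TYPE(complex) n) S"

end

theory Submission
  imports Defs
begin

text \<open>If a positive semidefinite matrix \<open>M\<close> satisfies \<open>\<langle>x, M x\<rangle> = 0\<close>, then \<open>M x = 0\<close>. A rank-one
  diagonal block with ray \<open>\<psi>\<close> is annihilated by the vectors
  \<open>cnj \<psi>\<^sub>k e\<^sub>i - cnj \<psi>\<^sub>i e\<^sub>k\<close>, hence so are all the blocks in its columns. Entrywise this says that
  the off-diagonal blocks have all \<open>2 \<times> 2\<close> minors against \<open>\<psi>\<close> equal to zero, and dividing by a
  nonzero entry of \<open>\<psi>\<close> gives the multiples.\<close>

lemma mat_adjoint_dim [simp]:
  "dim_row (mat_adjoint A) = dim_col A" "dim_col (mat_adjoint A) = dim_row A"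
  by (auto simp: mat_adjoint_def)

lemma mat_adjoint_index [simp]:
  "i < dim_col A \<Longrightarrow> j < dim_row A \<Longrightarrow> mat_adjoint A $$ (i, j) = conjugate (A $$ (j, i))"
  by (auto simp: mat_adjoint_def mat_of_rows_index)

lemma mat_adjoint_conv_transpose:
  "mat_adjoint A = transpose_mat (map_mat conjugate A)"
  by (rule eq_matI) auto

lemma conjugate_mult_mat_vec:
  fixes A :: "'a :: conjugatable_field mat"
  assumes "A \<in> carrier_mat m n" "v \<in> carrier_vec n"
  shows "conjugate (A *\<^sub>v v) = map_mat conjugate A *\<^sub>v conjugate v"
  using assms
  by (intro eq_vecI)
    (auto simp: scalar_prod_def sum_conjugate conjugate_dist_mul)

text \<open>This is the bilinear transpose rule applied to the entrywise conjugate of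
  \<open>A\<close> and to \<open>conjugate v\<close>. For self-adjoint \<open>A\<close> it moves
  \<open>A\<close> across the inner product.\<close>

lemma cscalar_prod_mult_mat_vec:
  fixes A :: "'a :: conjugatable_field mat"
  assumes A: "A \<in> carrier_mat m n" and v: "v \<in> carrier_vec n" and w: "w \<in> carrier_vec m"
  shows "w \<bullet>c (A *\<^sub>v v) = (mat_adjoint A *\<^sub>v w) \<bullet>c v"
  using transpose_vec_mult_scalar[of "map_mat conjugate A" m n "conjugate v" w] assms
  by (simp add: conjugate_mult_mat_vec[OF A v] mat_adjoint_conv_transpose)

text \<open>A variational argument: with \<open>y = M *\<^sub>v x\<close>, the form at x - s y
  equals \<open>s * s * Q - 2 * s * N\<close>, where \<open>N\<close> is the squared norm of
  \<open>y\<close>. For small positive s the linear term dominates, so nonnegativity forces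
  \<open>N\<close> to vanish.\<close>

lemma psd_kernel:
  assumes psd: "positive_semidefinite M" and M: "M \<in> carrier_mat n n"
    and x: "x \<in> carrier_vec n" and zero: "(M *\<^sub>v x) \<bullet>c x = 0"
  shows "M *\<^sub>v x = 0\<^sub>v n"
proof -
  define y where "y = M *\<^sub>v x"
  have y: "y \<in> carrier_vec n" and My: "M *\<^sub>v y \<in> carrier_vec n" using M x y_def by auto
  have adj: "mat_adjoint M = M" using psd by (simp add: positive_semidefinite_def)
  define N where "N = Re (y \<bullet>c y)"
  define Q where "Q = Re ((M *\<^sub>v y) \<bullet>c y)"
  have N: "y \<bullet>c y = of_real N"
    using conjugate_square_ge_0_vec[of y] by (simp add: N_def complex_eq_iff less_eq_complex_def)
  \<comment> \<open>Self-adjointness makes the two cross terms of the expansion below equal, both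
    being the squared norm of \<open>y\<close>.\<close>
  have Myx: "(M *\<^sub>v y) \<bullet>c x = y \<bullet>c y"
    using cscalar_prod_mult_mat_vec[OF M x y] adj by (simp add: y_def)
  have expand: "0 \<le> s * s * Q - 2 * s * N" for s :: real
  proof -
    let ?s = "complex_of_real (- s)"
    let ?z = "x + ?s \<cdot>\<^sub>v y"
    have "M *\<^sub>v ?z = y + ?s \<cdot>\<^sub>v (M *\<^sub>v y)"
      using M x y by (simp add: mult_add_distrib_mat_vec mult_mat_vec y_def)
    moreover have "conjugate ?z = conjugate x + ?s \<cdot>\<^sub>v conjugate y"
      using x y by (simp add: conjugate_add_vec[of _ n] conjugate_smult_vec)
    ultimately have "(M *\<^sub>v ?z) \<bullet>c ?z
        = y \<bullet>c x + ?s * (y \<bullet>c y) + ?s * ((M *\<^sub>v y) \<bullet>c x) + ?s * ?s * ((M *\<^sub>v y) \<bullet>c y)"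
      using x y My
      by (simp add: add_scalar_prod_distrib[of _ n] scalar_prod_add_distrib[of _ n] algebra_simps)
    also have "\<dots> = 2 * ?s * of_real N + ?s * ?s * ((M *\<^sub>v y) \<bullet>c y)"
      using zero by (simp add: Myx N y_def[symmetric])
    finally have eq: "(M *\<^sub>v ?z) \<bullet>c ?z = 2 * ?s * of_real N + ?s * ?s * ((M *\<^sub>v y) \<bullet>c y)" .
    have "0 \<le> (M *\<^sub>v ?z) \<bullet>c ?z"
      using psd M x y by (simp add: positive_semidefinite_def)
    then have "0 \<le> Re ((M *\<^sub>v ?z) \<bullet>c ?z)"
      by (simp add: less_eq_complex_def)
    then show ?thesis unfolding eq by (simp add: Q_def)
  qed
  have "N \<le> 0"
  proof (rule ccontr)
    assume "\<not> N \<le> 0"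
    \<comment> \<open>With this s the quadratic term satisfies s Q \<le> N, against the required 2 N
      \<le> s Q. The summand 1 keeps the denominator positive when \<open>Q\<close> is zero.\<close>
    define s where "s = N / (\<bar>Q\<bar> + 1)"
    have s: "s > 0" "s * (\<bar>Q\<bar> + 1) = N" using \<open>\<not> N \<le> 0\<close> by (auto simp: s_def)
    have "0 \<le> s * (s * Q - 2 * N)" using expand[of s] by (simp add: algebra_simps)
    then have "2 * N \<le> s * Q" using s by (simp add: zero_le_mult_iff)
    also have "\<dots> \<le> s * (\<bar>Q\<bar> + 1)" using s by (intro mult_left_mono) auto
    finally show False using s \<open>\<not> N \<le> 0\<close> by simp
  qed
  moreover have "0 \<le> N" using conjugate_square_ge_0_vec[of y] by (simp add: N_def less_eq_complex_def)
  ultimately have "y \<bullet>c y = 0" using N by simp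
  then show ?thesis using y by (simp add: y_def)
qed

text \<open>The entries at \<open>i\<close> and \<open>k\<close> form the rank-one block of the
  vector (a, b), which annihilates (cnj b, - cnj a). Padded with zeros, this vector has zero
  quadratic form, so all of \<open>M\<close> annihilates it; row \<open>r\<close>, possibly outside
  the block, gives the identity.\<close>

lemma psd_rank_one_minor:
  assumes psd: "positive_semidefinite M" and M: "M \<in> carrier_mat n n"
    and i: "i < n" and k: "k < n" and r: "r < n"
    and ent: "M $$ (i, i) = a * cnj a" "M $$ (i, k) = a * cnj b"
      "M $$ (k, i) = b * cnj a" "M $$ (k, k) = b * cnj b"
  shows "M $$ (r, i) * cnj b = M $$ (r, k) * cnj a"
proof -
  define x where "x = cnj b \<cdot>\<^sub>v unit_vec n i + (- cnj a) \<cdot>\<^sub>v unit_vec n k"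
  have x: "x \<in> carrier_vec n" by (simp add: x_def)
  have Mx: "(M *\<^sub>v x) $ p = M $$ (p, i) * cnj b - M $$ (p, k) * cnj a" if "p < n" for p
    using that M i k unfolding x_def
    by (simp add: scalar_prod_add_distrib[of _ n] scalar_prod_right_unit)
  have cx: "conjugate x = b \<cdot>\<^sub>v unit_vec n i + (- a) \<cdot>\<^sub>v unit_vec n k"
    by (rule eq_vecI) (auto simp: x_def unit_vec_def)
  have "(M *\<^sub>v x) \<bullet>c x = b * (M *\<^sub>v x) $ i - a * (M *\<^sub>v x) $ k"
    using M i k x unfolding cx
    by (simp add: scalar_prod_add_distrib[of _ n] scalar_prod_right_unit)
  also have "\<dots> = 0" using i k by (simp add: Mx ent algebra_simps)
  finally have "M *\<^sub>v x = 0\<^sub>v n" by (rule psd_kernel[OF psd M x])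
  then show ?thesis using Mx[OF r] r by simp
qed

lemma ketbra_dim [simp]: "dim_row (ketbra u v) = dim_vec u" "dim_col (ketbra u v) = dim_vec v"
  by (simp_all add: ketbra_def)

lemma ketbra_index [simp]:
  "i < dim_vec u \<Longrightarrow> j < dim_vec v \<Longrightarrow> ketbra u v $$ (i, j) = u $ i * cnj (v $ j)"
  by (simp add: ketbra_def)

lemma mat_adjoint_smult_ketbra:
  "mat_adjoint (k \<cdot>\<^sub>m ketbra u v) = cnj k \<cdot>\<^sub>m ketbra v u"
  by (rule eq_matI) auto

lemma smult_in_vec_span_singleton:
  assumes "u \<in> carrier_vec n"
  shows "k \<cdot>\<^sub>v u \<in> vec_span n {u}"
proof -
  interpret vec_space "TYPE(complex)" n .
  show ?thesis using assms by (intro smult_in_span span_mem) auto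
qed

text \<open>Every column is a multiple of \<open>u\<close>, with factor
  \<open>k * cnj (v $ j)\<close>, so the columns cannot span more than the line through
  \<open>u\<close>.\<close>

lemma col_space_smult_ketbra:
  assumes u: "u \<in> carrier_vec n"
  shows "vec_space.col_space n (k \<cdot>\<^sub>m ketbra u v) \<subseteq> vec_span n {u}"
proof -
  interpret vec_space "TYPE(complex)" n .
  have "col (k \<cdot>\<^sub>m ketbra u v) j = (k * cnj (v $ j)) \<cdot>\<^sub>v u" if "j < dim_vec v" for j
    using that by (intro eq_vecI) auto
  then have "set (cols (k \<cdot>\<^sub>m ketbra u v)) = (\<lambda>j. (k * cnj (v $ j)) \<cdot>\<^sub>v u) ` {..<dim_vec v}"
    by (auto simp: cols_def image_iff simp del: col_smult)
  then have "set (cols (k \<cdot>\<^sub>m ketbra u v)) \<subseteq> span {u}"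
    using smult_in_vec_span_singleton[OF u] by (simp only: image_subset_iff) simp
  then show ?thesis using u unfolding col_space_def by (intro span_subsetI) auto
qed

lemma nonzero_vec_entry:
  assumes "v \<in> carrier_vec n" "v \<noteq> 0\<^sub>v n"
  obtains k where "k < n" "v $ k \<noteq> 0"
proof -
  have "\<exists>k<n. v $ k \<noteq> 0"
  proof (rule ccontr)
    assume "\<not> (\<exists>k<n. v $ k \<noteq> 0)"
    then have "v = 0\<^sub>v n" using assms(1) by (intro eq_vecI) auto
    with assms(2) show False ..
  qed
  then show thesis using that by blast
qed

lemma vec_multiple_of_minors:
  fixes u v :: "complex vec"
  assumes u: "u \<in> carrier_vec n" "u \<noteq> 0\<^sub>v n" and v: "v \<in> carrier_vec n"
    and minor: "\<And>i k. i < n \<Longrightarrow> k < n \<Longrightarrow> v $ i * u $ k = v $ k * u $ i"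
  shows "\<exists>\<alpha>. v = \<alpha> \<cdot>\<^sub>v u"
proof -
  obtain k where k: "k < n" "u $ k \<noteq> 0" using nonzero_vec_entry[OF u] .
  have "v = (v $ k / u $ k) \<cdot>\<^sub>v u"
    using u v k minor[OF _ k(1)] by (intro eq_vecI) (auto simp: field_simps)
  then show ?thesis ..
qed

text \<open>The condition \<open>rows\<close> makes each column of \<open>A\<close> proportional to
  \<open>u\<close>; \<open>cols\<close> makes each row proportional to the conjugate of
  \<open>v\<close>. Together they leave one free scalar.\<close>

lemma mat_multiple_of_minors:
  assumes u: "u \<in> carrier_vec m" "u \<noteq> 0\<^sub>v m" and v: "v \<in> carrier_vec n" "v \<noteq> 0\<^sub>v n"
    and A: "A \<in> carrier_mat m n"
    and rows: "\<And>i k j. i < m \<Longrightarrow> k < m \<Longrightarrow> j < n \<Longrightarrow> A $$ (i, j) * u $ k = A $$ (k, j) * u $ i"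
    and cols: "\<And>i j l. i < m \<Longrightarrow> j < n \<Longrightarrow> l < n \<Longrightarrow>
      A $$ (i, j) * cnj (v $ l) = A $$ (i, l) * cnj (v $ j)"
  shows "\<exists>\<mu>. A = \<mu> \<cdot>\<^sub>m ketbra u v"
proof -
  obtain k where k: "k < m" "u $ k \<noteq> 0" using nonzero_vec_entry[OF u] .
  obtain l where l: "l < n" "v $ l \<noteq> 0" using nonzero_vec_entry[OF v] .
  \<comment> \<open>The scalar is read off at the pivot \<open>(k, l)\<close>: go from
    \<open>(i, j)\<close> to \<open>(k, j)\<close> within the column, then to \<open>(k, l)\<close>
    within the row.\<close>
  have "A $$ (i, j) = A $$ (k, l) / (u $ k * cnj (v $ l)) * (u $ i * cnj (v $ j))"
    if "i < m" "j < n" for i j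
  proof -
    have "A $$ (i, j) = A $$ (k, j) / u $ k * u $ i"
      using rows[OF that(1) k(1) that(2)] k by (simp add: field_simps)
    moreover have "A $$ (k, j) = A $$ (k, l) / cnj (v $ l) * cnj (v $ j)"
      using cols[OF k(1) that(2) l(1)] l by (simp add: field_simps)
    ultimately show ?thesis by (simp add: mult_ac)
  qed
  then have "A = (A $$ (k, l) / (u $ k * cnj (v $ l))) \<cdot>\<^sub>m ketbra u v"
    using u v A by (intro eq_matI) auto
  then show ?thesis ..
qed

lemma block_gram_carrier:
  assumes "A01 \<in> carrier_mat m m" "A12 \<in> carrier_mat n n"
  shows "block_gram A01 A12 F D E c \<in> carrier_mat (m + n + 1) (m + n + 1)"
  using assms by (auto simp: block_gram_def Let_def)

text \<open>The last block column is left out: \<open>D\<close> and \<open>E\<close> are read,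
  conjugated, from the bottom row \<open>m + n\<close>.\<close>

lemma block_gram_index:
  assumes "A01 \<in> carrier_mat m m" "A12 \<in> carrier_mat n n" "F \<in> carrier_mat m n"
    and "D \<in> carrier_vec m" "E \<in> carrier_vec n"
  shows "i < m \<Longrightarrow> j < m \<Longrightarrow> block_gram A01 A12 F D E c $$ (i, j) = A01 $$ (i, j)"
    and "i < m \<Longrightarrow> l < n \<Longrightarrow> block_gram A01 A12 F D E c $$ (i, m + l) = F $$ (i, l)"
    and "k < n \<Longrightarrow> j < m \<Longrightarrow> block_gram A01 A12 F D E c $$ (m + k, j) = cnj (F $$ (j, k))"
    and "k < n \<Longrightarrow> l < n \<Longrightarrow> block_gram A01 A12 F D E c $$ (m + k, m + l) = A12 $$ (k, l)"
    and "j < m \<Longrightarrow> block_gram A01 A12 F D E c $$ (m + n, j) = cnj (D $ j)"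
    and "l < n \<Longrightarrow> block_gram A01 A12 F D E c $$ (m + n, m + l) = cnj (E $ l)"
  using assms by (auto simp: block_gram_def Let_def mat_of_cols_index)

lemma rank_one_blocks:
  assumes F: "F \<in> carrier_mat m n" and D: "D \<in> carrier_vec m" and E: "E \<in> carrier_vec n"
    and u: "u \<in> carrier_vec m" "u \<noteq> 0\<^sub>v m" and v: "v \<in> carrier_vec n" "v \<noteq> 0\<^sub>v n"
    and psd: "positive_semidefinite (block_gram (ketbra u u) (ketbra v v) F D E c)"
  shows "\<exists>\<alpha> \<beta> \<mu>. D = \<alpha> \<cdot>\<^sub>v u \<and> E = \<beta> \<cdot>\<^sub>v v \<and> F = \<mu> \<cdot>\<^sub>m ketbra u v"
proof -
  let ?M = "block_gram (ketbra u u) (ketbra v v) F D E c"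
  have A: "ketbra u u \<in> carrier_mat m m" "ketbra v v \<in> carrier_mat n n" using u v by auto
  note M = block_gram_carrier[OF A, of F D E c]
  note idx = block_gram_index[OF A F D E]
  \<comment> \<open>Here a and b are the entries \<open>u $ i\<close> and \<open>u $ k\<close>. The
    row \<open>r\<close> stays free, to be placed in each of the other blocks in turn.\<close>
  have minor_u: "?M $$ (r, i) * cnj (u $ k) = ?M $$ (r, k) * cnj (u $ i)"
    if "i < m" "k < m" "r < m + n + 1" for i k r
    using that u by (intro psd_rank_one_minor[OF psd M]) (auto simp: idx)
  have minor_v: "?M $$ (r, m + j) * cnj (v $ l) = ?M $$ (r, m + l) * cnj (v $ j)"
    if "j < n" "l < n" "r < m + n + 1" for j l r
    using that v by (intro psd_rank_one_minor[OF psd M]) (auto simp: idx)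
  \<comment> \<open>The bottom row holds the conjugates of \<open>D\<close>, so the whole identity
    is conjugated.\<close>
  have "D $ i * u $ k = D $ k * u $ i" if "i < m" "k < m" for i k
    using arg_cong[OF minor_u[OF that, of "m + n"], of cnj] that by (simp add: idx)
  then obtain \<alpha> where "D = \<alpha> \<cdot>\<^sub>v u" using vec_multiple_of_minors[OF u D] by blast
  moreover have "E $ j * v $ l = E $ l * v $ j" if "j < n" "l < n" for j l
    using arg_cong[OF minor_v[OF that, of "m + n"], of cnj] that by (simp add: idx)
  then obtain \<beta> where "E = \<beta> \<cdot>\<^sub>v v" using vec_multiple_of_minors[OF v E] by blast
  \<comment> \<open>Row \<open>m + j\<close> lies in the adjoint of \<open>F\<close>, hence another
    conjugation; the next step reads \<open>F\<close> itself in row \<open>i\<close> and needs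
    none.\<close>
  moreover have "F $$ (i, j) * u $ k = F $$ (k, j) * u $ i" if "i < m" "k < m" "j < n" for i k j
    using arg_cong[OF minor_u[OF that(1,2), of "m + j"], of cnj] that by (simp add: idx)
  moreover have "F $$ (i, j) * cnj (v $ l) = F $$ (i, l) * cnj (v $ j)"
    if "i < m" "j < n" "l < n" for i j l
    using minor_v[OF that(2,3), of i] that by (simp add: idx)
  ultimately show ?thesis using mat_multiple_of_minors[OF u v F] by blast
qed

theorem proposition5:
  fixes g :: nat
    and A01 A12 F :: "complex mat"
    and D E \<psi>01 \<psi>12 :: "complex vec"
    and c :: real
  assumes "g \<ge> 2"
    and "A01 \<in> carrier_mat g g" and "A12 \<in> carrier_mat g g" and "F \<in> carrier_mat g g"
    and "D \<in> carrier_vec g" and "E \<in> carrier_vec g"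
    and "c \<ge> 0"
    and "positive_semidefinite (block_gram A01 A12 F D E c)"
    and "\<psi>01 \<in> carrier_vec g" and "\<psi>01 \<noteq> 0\<^sub>v g"
    and "\<psi>12 \<in> carrier_vec g" and "\<psi>12 \<noteq> 0\<^sub>v g"
    and "A01 = ketbra \<psi>01 \<psi>01" and "A12 = ketbra \<psi>12 \<psi>12"
  shows "(\<exists>\<alpha> \<beta> \<mu> :: complex.
            D = \<alpha> \<cdot>\<^sub>v \<psi>01 \<and> E = \<beta> \<cdot>\<^sub>v \<psi>12 \<and> F = \<mu> \<cdot>\<^sub>m ketbra \<psi>01 \<psi>12)
       \<and> ((\<exists>\<alpha> \<beta> \<mu> :: complex.
            D = \<alpha> \<cdot>\<^sub>v \<psi>01 \<and> E = \<beta> \<cdot>\<^sub>v \<psi>12 \<and> F = \<mu> \<cdot>\<^sub>m ketbra \<psi>01 \<psi>12)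
          \<longleftrightarrow> (D \<in> vec_span g {\<psi>01} \<and> E \<in> vec_span g {\<psi>12}
             \<and> vec_space.col_space g F \<subseteq> vec_span g {\<psi>01}
             \<and> vec_space.col_space g (mat_adjoint F) \<subseteq> vec_span g {\<psi>12}))"
proof -
  obtain \<alpha> \<beta> \<mu> where eq: "D = \<alpha> \<cdot>\<^sub>v \<psi>01" "E = \<beta> \<cdot>\<^sub>v \<psi>12" "F = \<mu> \<cdot>\<^sub>m ketbra \<psi>01 \<psi>12"
    using rank_one_blocks[of F g g D E \<psi>01 \<psi>12 c] assms by blast
  \<comment> \<open>The multiples are already established, so the equivalence follows once its
    right-hand side is shown to hold as well.\<close>
  have "D \<in> vec_span g {\<psi>01}" "E \<in> vec_span g {\<psi>12}"
    unfolding eq using assms by (auto intro: smult_in_vec_span_singleton)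
  \<comment> \<open>Taking the adjoint swaps the two rays and conjugates \<mu>, so one column-space
    lemma covers both ranges.\<close>
  moreover have "vec_space.col_space g F \<subseteq> vec_span g {\<psi>01}"
    "vec_space.col_space g (mat_adjoint F) \<subseteq> vec_span g {\<psi>12}"
    unfolding eq mat_adjoint_smult_ketbra using assms by (auto intro!: col_space_smult_ketbra)
  ultimately show ?thesis using eq by blast
qed

end
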